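(* Let $k>0$ and $y\in(-k,k)$. Then $$\sum_{n=-\infty}^{\infty}(-1)^n\operatorname{sech}\Big(\frac\pi2\big(2kn+(-1)^ny\big)\Big)=\frac{2\cos(\frac{\pi y}{2k})}{k}\sum_{m=0}^\infty(-1)^m\frac{\sinh\big(\frac{(2m+1)\pi}{2k}\big)}{\sinh^2\big(\frac{(2m+1)\pi}{2k}\big)+\sin^2\big(\frac{\pi y}{2k}\big)}.$$
   Context: $\operatorname{sech}=1/\cosh$. *)

theory Defs
  imports "HOL-Analysis.Analysis"
begin

definition sech :: "real \<Rightarrow> real" where
  "sech x = 1 / cosh x"

end

theory Submission
  imports Defs "HOL-Complex_Analysis.Complex_Analysis" "HOL-Real_Asymp.Real_Asymp"
begin

text \<open>
  Put \<open>c = y / 2\<close>. Both sums are sums of residues of the single meromorphic function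
  \<open>h(z) = (\<pi> / k) / (cosh (\<pi> z) sin (\<pi> (z - c) / k))\<close>, called \<open>kern\<close> below. At a zero \<open>k n + c\<close> of the
  sine its residue is \<open>(-1)^n sech (\<pi> (k n + c))\<close> (\<open>residue_kern_real_pole\<close>); the zeros of \<open>cosh\<close>
  are the points \<open>\<i> (m + 1/2)\<close>, and the residues at \<open>m\<close> and \<open>- m - 1\<close> together give minus the \<open>m\<close>-th
  term of the right-hand side (\<open>residue_kern_imag_pole_pair\<close>).

  The residue theorem is applied to the rectangle with centre \<open>c\<close>, half-width \<open>k (N + 1/2)\<close> and
  half-height \<open>N\<close> (\<open>kern_residue_theorem\<close>). With these dimensions, \<open>\<bar>cosh (\<pi> z)\<bar>\<close> is at least \<open>1\<close> on the
  horizontal sides, where the sine is exponentially large, and the sine has modulus at least \<open>1\<close> on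
  the vertical sides, where \<open>cosh\<close> is exponentially large. The integral therefore tends to \<open>0\<close>
  (\<open>kern_contour_integral_tendsto_0\<close>), so all residues add up to \<open>0\<close>. Because both series converge
  absolutely, the symmetric partial sums produced by the rectangles have the sums of the series as
  their limits (\<open>infsum_real_term_eq\<close>).

  On the left-hand side of the theorem the sign in front of \<open>y\<close> alternates with \<open>n\<close>. Since
  \<open>sech\<close> is even, the substitution \<open>n \<mapsto> - n\<close> on the odd integers removes that alternation.
\<close>

section \<open>Complex trigonometric functions\<close>

lemma norm_cos_sinh: "norm (cos z) ^ 2 = cos (Re z) ^ 2 + sinh (Im z) ^ 2"
  by (simp add: norm_cos_squared sinh_field_def exp_minus power_divide)

lemma norm_sin_sinh: "norm (sin z) ^ 2 = sin (Re z) ^ 2 + sinh (Im z) ^ 2"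
proof -
  have "norm (sin z) = norm (cos (of_real pi / 2 - z))"
    by (simp add: sin_cos_eq)
  also have "norm (cos (of_real pi / 2 - z)) ^ 2 = sin (Re z) ^ 2 + sinh (Im z) ^ 2"
    unfolding norm_cos_sinh by (simp add: sin_cos_eq)
  finally show ?thesis .
qed

lemma cos_pi_of_int: "cos (of_real pi * of_int n) = ((-1) powi n :: complex)"
proof -
  have "of_real pi * of_int n = (of_real (pi * of_int n) :: complex)"
    by simp
  then show ?thesis
    by (simp only: cos_of_real cos_npi_int) (simp add: power_int_minus_left)
qed

lemma cosh_complex_of_real: "cosh (of_real x :: complex) = of_real (cosh x)"
  by (simp add: cosh_field_def exp_of_real flip: of_real_minus)

lemma sinh_complex_of_real: "sinh (of_real x :: complex) = of_real (sinh x)"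
  by (simp add: sinh_field_def exp_of_real flip: of_real_minus)

section \<open>The kernel, its poles and its residues\<close>

text \<open>The hyperbolic cosine is written as \<open>cos (\<i> \<pi> z)\<close>, so that zeros, derivatives and moduli of both
  factors of the denominator come from the same facts about \<open>sin\<close> and \<open>cos\<close>.\<close>

definition kern :: "real \<Rightarrow> real \<Rightarrow> complex \<Rightarrow> complex" where
  "kern k c z = of_real (pi / k) / (cos (\<i> * of_real pi * z) * sin (of_real pi * (z - of_real c) / of_real k))"

definition real_pole :: "real \<Rightarrow> real \<Rightarrow> int \<Rightarrow> complex" where
  "real_pole k c n = of_real (k * of_int n + c)"

definition imag_pole :: "int \<Rightarrow> complex" where
  "imag_pole m = \<i> * of_real (of_int m + 1/2)"

text \<open>The two families of poles are disjoint, because \<open>m + 1/2\<close> is never \<open>0\<close>; hence every pole of the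
  kernel is simple.\<close>

lemma imag_pole_not_real_pole: "imag_pole m \<notin> range (real_pole k c)"
proof
  assume "imag_pole m \<in> range (real_pole k c)"
  then have "Im (imag_pole m) = 0"
    by (auto simp: real_pole_def)
  then have "of_int (2 * m + 1) = (of_int 0 :: real)"
    by (simp add: imag_pole_def)
  then show False
    unfolding of_int_eq_iff by presburger
qed

lemma cos_kern_zero_iff: "cos (\<i> * of_real pi * z) = 0 \<longleftrightarrow> z \<in> range imag_pole"
proof
  assume "cos (\<i> * of_real pi * z) = 0"
  then obtain n :: int where n: "\<i> * of_real pi * z = of_real (n * pi) + of_real pi / 2"
    unfolding cos_eq_0 by blast
  have "\<i> * (\<i> * of_real pi * z) = \<i> * (of_real (n * pi) + of_real pi / 2)"
    by (simp only: n)
  then have "of_real pi * (- z) = of_real pi * (\<i> * (of_int n + 1/2))"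
    by (simp add: algebra_simps)
  then have "- z = \<i> * (of_int n + 1/2)"
    by (subst (asm) mult_cancel_left) simp
  then have "z = imag_pole (- n - 1)"
    by (simp add: imag_pole_def algebra_simps minus_equation_iff[of z])
  then show "z \<in> range imag_pole" by blast
next
  assume "z \<in> range imag_pole"
  then obtain m where "z = imag_pole m" by blast
  then have "\<i> * of_real pi * z = of_real (of_int (- m - 1) * pi) + of_real pi / 2"
    by (simp add: imag_pole_def algebra_simps)
  then show "cos (\<i> * of_real pi * z) = 0"
    unfolding cos_eq_0 by blast
qed

lemma sin_kern_zero_iff:
  assumes "k > 0"
  shows "sin (of_real pi * (z - of_real c) / of_real k) = 0 \<longleftrightarrow> z \<in> range (real_pole k c)"
proof -
  have "of_real pi * (z - of_real c) / of_real k = of_real (of_int n * pi) \<longleftrightarrow> z = real_pole k c n" for n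
  proof -
    have "of_real pi * (z - of_real c) / of_real k = of_real (of_int n * pi)
        \<longleftrightarrow> of_real pi * (z - of_real c) = of_real pi * (of_real k * of_int n)"
      using assms by (simp add: field_simps)
    also have "\<dots> \<longleftrightarrow> z - of_real c = of_real k * of_int n"
      by (subst mult_cancel_left) simp
    finally show ?thesis
      by (simp add: real_pole_def algebra_simps)
  qed
  then show ?thesis
    unfolding sin_eq_0 by auto
qed

lemma residue_inverse_simple_zero:
  assumes "g holomorphic_on UNIV" "(g has_field_derivative g') (at z)" "g z = 0" "g' \<noteq> 0" "a \<noteq> 0"
  shows "residue (\<lambda>w. a / g w) z = a / g'"
  using assms by (intro residue_simple_pole_deriv[where s = UNIV]) auto

lemma residue_kern_real_pole:
  assumes "k > 0"
  shows "residue (kern k c) (real_pole k c n) = of_real ((-1) powi n * sech (pi * (k * of_int n + c)))"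
proof -
  let ?g = "\<lambda>z. cos (\<i> * of_real pi * z) * sin (of_real pi * (z - of_real c) / of_real k)"
  let ?p = "real_pole k c n"
  have s: "of_real pi * (?p - of_real c) / of_real k = of_real pi * of_int n"
    using assms by (simp add: real_pole_def)
  have s0: "sin (of_real pi * (?p - of_real c) / of_real k) = 0"
    unfolding sin_kern_zero_iff[OF assms] by simp
  have c: "cos (\<i> * of_real pi * ?p) = of_real (cosh (pi * (k * of_int n + c)))"
    unfolding cosh_complex_of_real[symmetric] by (simp add: real_pole_def cosh_conv_cos mult.assoc)
  have c0: "cosh (pi * (k * of_int n + c)) \<noteq> 0" by simp
  have "(?g has_field_derivative
      cos (\<i> * of_real pi * ?p) * (cos (of_real pi * (?p - of_real c) / of_real k) * (of_real pi / of_real k))) (at ?p)"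
    using assms s0 by (auto intro!: derivative_eq_intros)
  then have D: "(?g has_field_derivative
      of_real (cosh (pi * (k * of_int n + c))) * ((-1) powi n * (of_real pi / of_real k))) (at ?p)"
    by (simp only: s c cos_pi_of_int)
  have "residue (kern k c) ?p = of_real (pi / k) /
      (of_real (cosh (pi * (k * of_int n + c))) * ((-1) powi n * (of_real pi / of_real k)))"
    unfolding kern_def using assms c0
    by (intro residue_inverse_simple_zero[OF _ D]) (auto intro!: holomorphic_intros simp: s0)
  also have "\<dots> = of_real ((-1) powi n * sech (pi * (k * of_int n + c)))"
    using assms c0 by (cases "even n") (simp_all add: sech_def power_int_minus_left)
  finally show ?thesis .
qed

lemma residue_kern_imag_pole:
  assumes "k > 0"
  shows "residue (kern k c) (imag_pole m) =
    (-1) powi m / (\<i> * of_real k * sin (of_real pi * (imag_pole m - of_real c) / of_real k))"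
proof -
  let ?g = "\<lambda>z. cos (\<i> * of_real pi * z) * sin (of_real pi * (z - of_real c) / of_real k)"
  let ?p = "imag_pole m"
  let ?s = "sin (of_real pi * (?p - of_real c) / of_real k)"
  have c0: "cos (\<i> * of_real pi * ?p) = 0"
    unfolding cos_kern_zero_iff by simp
  have s0: "?s \<noteq> 0"
    using imag_pole_not_real_pole by (simp add: sin_kern_zero_iff[OF assms])
  have "\<i> * of_real pi * ?p = - (of_real pi * of_int m + of_real pi / 2)"
    by (simp add: imag_pole_def algebra_simps)
  then have s: "sin (\<i> * of_real pi * ?p) = - ((-1) powi m)"
    by (simp only: sin_minus sin_add cos_pi_of_int) simp
  have "(?g has_field_derivative
      - (sin (\<i> * of_real pi * ?p) * (\<i> * of_real pi)) * ?s) (at ?p)"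
    using assms c0 by (auto intro!: derivative_eq_intros)
  then have D: "(?g has_field_derivative (-1) powi m * (\<i> * of_real pi) * ?s) (at ?p)"
    by (simp add: s)
  have "residue (kern k c) ?p = of_real (pi / k) / ((-1) powi m * (\<i> * of_real pi) * ?s)"
    unfolding kern_def using assms s0
    by (intro residue_inverse_simple_zero[OF _ D]) (auto intro!: holomorphic_intros simp: c0)
  also have "\<dots> = (-1) powi m / (\<i> * of_real k * ?s)"
    using assms by (cases "even m") (simp_all add: power_int_minus_left)
  finally show ?thesis .
qed

lemma holomorphic_kern:
  assumes "k > 0" "A \<inter> (range (real_pole k c) \<union> range imag_pole) = {}"
  shows "kern k c holomorphic_on A"
  unfolding kern_def
proof (intro holomorphic_intros)
  fix z assume "z \<in> A"
  then show "cos (\<i> * of_real pi * z) * sin (of_real pi * (z - of_real c) / of_real k) \<noteq> 0"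
    using assms by (auto simp only: mult_eq_0_iff cos_kern_zero_iff sin_kern_zero_iff)
qed (use assms in auto)

section \<open>The kernel on the sides of the rectangles\<close>

lemma norm_kern_le:
  assumes "k > 0" "0 < u" "0 < v"
    "u ^ 2 \<le> norm (cos (\<i> * of_real pi * z)) ^ 2"
    "v ^ 2 \<le> norm (sin (of_real pi * (z - of_real c) / of_real k)) ^ 2"
  shows "norm (kern k c z) \<le> pi / k / (u * v)"
proof -
  have "u \<le> norm (cos (\<i> * of_real pi * z))"
    "v \<le> norm (sin (of_real pi * (z - of_real c) / of_real k))"
    using assms by (auto intro: power2_le_imp_le)
  then have "u * v \<le> norm (cos (\<i> * of_real pi * z)) * norm (sin (of_real pi * (z - of_real c) / of_real k))"
    using assms by (intro mult_mono) auto
  moreover have "0 < u * v"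
    using assms by simp
  ultimately show ?thesis
    unfolding kern_def norm_divide norm_mult using assms(1)
    by (intro frac_le) (auto simp: norm_divide)
qed

text \<open>At integer height \<open>\<bar>cos (\<pi> Im z)\<bar> = 1\<close>, which keeps \<open>cosh (\<pi> z)\<close> away from \<open>0\<close>; the sine
  provides the decay.\<close>

lemma norm_kern_horizontal:
  assumes "k > 0" "\<bar>Im z\<bar> = real N" "N > 0"
  shows "norm (kern k c z) \<le> pi / k / sinh (pi * real N / k)"
proof -
  have Im: "Im z = real N \<or> Im z = - real N"
    using assms(2) by linarith
  then have "cos (pi * Im z) ^ 2 = cos (pi * real N) ^ 2"
    by auto
  also have "\<dots> = 1"
    by (simp add: power_mult[symmetric])
  finally have 1: "cos (pi * Im z) ^ 2 = 1" .
  have "sinh (pi * Im z / k) ^ 2 = sinh (pi * real N / k) ^ 2"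
    using Im by auto
  with 1 have "norm (kern k c z) \<le> pi / k / (1 * sinh (pi * real N / k))"
    using assms by (intro norm_kern_le) (auto simp: norm_cos_sinh norm_sin_sinh)
  then show ?thesis by simp
qed

text \<open>Halfway between two zeros of the sine, \<open>\<bar>sin (\<pi> (Re z - c) / k)\<bar> = 1\<close>; the hyperbolic cosine
  provides the decay. The bound is stated with a lower bound \<open>r\<close> for \<open>\<bar>Re z\<bar>\<close> so that it serves both
  sides of a rectangle that is centred at \<open>c\<close> rather than at \<open>0\<close>.\<close>

lemma norm_kern_vertical:
  assumes "k > 0" "Re z = c + k * (of_int n + 1/2)" "0 < r" "r \<le> \<bar>Re z\<bar>"
  shows "norm (kern k c z) \<le> pi / k / sinh (pi * r)"
proof -
  have "pi * (Re z - c) / k = pi * of_int n + pi / 2"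
    using assms by (simp add: field_simps)
  then have 1: "sin (pi * (Re z - c) / k) ^ 2 = 1"
    by (simp add: sin_add)
  have "sinh (pi * r) \<le> sinh (pi * \<bar>Re z\<bar>)"
    using assms by simp
  then have "sinh (pi * r) ^ 2 \<le> sinh (pi * \<bar>Re z\<bar>) ^ 2"
    using assms by (intro power_mono) auto
  also have "\<dots> = sinh (pi * Re z) ^ 2"
    by (cases "Re z \<ge> 0") auto
  finally have "norm (kern k c z) \<le> pi / k / (sinh (pi * r) * 1)"
    using assms 1 by (intro norm_kern_le) (auto simp: norm_cos_sinh norm_sin_sinh add_increasing)
  then show ?thesis by simp
qed

lemma norm_contour_integral_rectpath_le:
  assumes cont: "continuous_on (path_image (rectpath a b)) f"
    and le: "Re a \<le> Re b" "Im a \<le> Im b"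
    and horizontal: "\<And>z. z \<in> path_image (rectpath a b) \<Longrightarrow> Im z = Im a \<or> Im z = Im b \<Longrightarrow> norm (f z) \<le> A"
    and vertical: "\<And>z. z \<in> path_image (rectpath a b) \<Longrightarrow> Re z = Re a \<or> Re z = Re b \<Longrightarrow> norm (f z) \<le> B"
  shows "norm (contour_integral (rectpath a b) f) \<le> 2 * A * (Re b - Re a) + 2 * B * (Im b - Im a)"
proof -
  define p q where "p = Complex (Re b) (Im a)" and "q = Complex (Re a) (Im b)"
  have image: "path_image (rectpath a b) =
      closed_segment a p \<union> closed_segment p b \<union> closed_segment b q \<union> closed_segment q a"
    by (simp add: rectpath_def Let_def path_image_join p_def q_def Un_assoc)
  have int: "f contour_integrable_on linepath a p" "f contour_integrable_on linepath p b"
    "f contour_integrable_on linepath b q" "f contour_integrable_on linepath q a"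
    using cont unfolding image
    by (auto intro!: contour_integrable_continuous_linepath elim: continuous_on_subset)
  have "0 \<le> norm (f a)" by simp
  also have "norm (f a) \<le> A" by (intro horizontal) (auto simp: image)
  finally have A: "0 \<le> A" .
  have "0 \<le> norm (f a)" by simp
  also have "norm (f a) \<le> B" by (intro vertical) (auto simp: image)
  finally have B: "0 \<le> B" .
  have lengths: "norm (p - a) = Re b - Re a" "norm (b - p) = Im b - Im a"
    "norm (q - b) = Re b - Re a" "norm (a - q) = Im b - Im a"
    using le by (auto simp: p_def q_def cmod_def)
  have "norm (contour_integral (linepath a p) f) \<le> A * norm (p - a)"
    by (rule contour_integral_bound_linepath[OF int(1) A], rule horizontal)
      (auto simp: image p_def closed_segment_same_Im)
  moreover have "norm (contour_integral (linepath p b) f) \<le> B * norm (b - p)"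
    by (rule contour_integral_bound_linepath[OF int(2) B], rule vertical)
      (auto simp: image p_def closed_segment_same_Re)
  moreover have "norm (contour_integral (linepath b q) f) \<le> A * norm (q - b)"
    by (rule contour_integral_bound_linepath[OF int(3) A], rule horizontal)
      (auto simp: image q_def closed_segment_same_Im)
  moreover have "norm (contour_integral (linepath q a) f) \<le> B * norm (a - q)"
    by (rule contour_integral_bound_linepath[OF int(4) B], rule vertical)
      (auto simp: image q_def closed_segment_same_Re)
  moreover have "contour_integral (rectpath a b) f =
      contour_integral (linepath a p) f + contour_integral (linepath p b) f +
      contour_integral (linepath b q) f + contour_integral (linepath q a) f"
    using int by (simp add: rectpath_def Let_def add.assoc flip: p_def q_def)
  moreover have "norm (w + x + y + z) \<le> W + X + Y + Z"
    if "norm w \<le> W" "norm x \<le> X" "norm y \<le> Y" "norm z \<le> Z" for w x y z :: complex and W X Y Z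
    using that by (intro norm_triangle_mono)
  ultimately have "norm (contour_integral (rectpath a b) f) \<le>
      A * (Re b - Re a) + B * (Im b - Im a) + A * (Re b - Re a) + B * (Im b - Im a)"
    by (simp only: lengths)
  then show ?thesis
    by (simp add: algebra_simps)
qed

section \<open>The residue theorem on growing rectangles\<close>

text \<open>Side length times the bound on a side has this form.\<close>

lemma linear_over_sinh_tendsto_0:
  fixes r a b :: real
  assumes "r > 0"
  shows "(\<lambda>N::nat. (a * real N + b) / sinh (r * real N)) \<longlonglongrightarrow> 0"
proof -
  have 1: "(\<lambda>N::nat. real N / sinh (r * real N)) \<longlonglongrightarrow> 0"
    using assms by real_asymp
  have 2: "(\<lambda>N::nat. 1 / sinh (r * real N)) \<longlonglongrightarrow> 0"
    using assms by real_asymp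
  show ?thesis
    using tendsto_add[OF tendsto_mult_left[OF 1, of a] tendsto_mult_left[OF 2, of b]]
    by (simp add: add_divide_distrib)
qed

text \<open>The vector from the centre of the rectangle to its upper right corner.\<close>

definition corner :: "real \<Rightarrow> nat \<Rightarrow> complex" where
  "corner k N = Complex (k * (real N + 1/2)) (real N)"

text \<open>The hypothesis on \<open>c\<close> puts the imaginary axis, and with it the poles \<open>\<i> (m + 1/2)\<close>, strictly
  between the vertical sides for every \<open>N\<close>.\<close>

lemma kern_residue_theorem:
  fixes N :: nat and k c :: real
  assumes k: "k > 0" and c: "\<bar>c\<bar> < k / 2" and N: "N > 0"
  defines "d \<equiv> corner k N"
  shows "path_image (rectpath (of_real c - d) (of_real c + d)) \<inter> (range (real_pole k c) \<union> range imag_pole) = {}"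
    "contour_integral (rectpath (of_real c - d) (of_real c + d)) (kern k c) = 2 * of_real pi * \<i> *
      ((\<Sum>n = - int N..int N. residue (kern k c) (real_pole k c n))
        + (\<Sum>m \<in> {- int N..<int N}. residue (kern k c) (imag_pole m)))"
proof -
  let ?a = "of_real c - d" and ?b = "of_real c + d"
  let ?\<gamma> = "rectpath ?a ?b"
  \<comment> \<open>The rectangle is widened by less than the distance to the next pole in each direction, so that
    the open neighbourhood \<open>S\<close> contains no further poles.\<close>
  define e where "e = Complex (k / 4) (1 / 4)"
  define S where "S = box (?a - e) (?b + e)"
  define P where "P = real_pole k c ` {- int N..int N} \<union> imag_pole ` {- int N..<int N}"
  have order: "Re ?a \<le> Re ?b" "Im ?a \<le> Im ?b"
    using k by (auto simp: d_def corner_def)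
  have inside: "P \<subseteq> box ?a ?b"
  proof -
    have "real_pole k c n \<in> box ?a ?b" if "n \<in> {- int N..int N}" for n
    proof -
      have "- real N \<le> of_int n" "of_int n \<le> real N"
        using that by auto
      then have "- (real N + 1/2) < of_int n" "of_int n < real N + 1/2"
        by auto
      then have "k * - (real N + 1/2) < k * of_int n" "k * of_int n < k * (real N + 1/2)"
        using k by (auto simp only: mult_less_cancel_left_pos)
      then have "- (k * (real N + 1/2)) < k * of_int n" "k * of_int n < k * (real N + 1/2)"
        by (auto simp only: mult_minus_right)
      then show ?thesis
        using N by (auto simp: d_def corner_def in_box_complex_iff real_pole_def)
    qed
    moreover have "imag_pole m \<in> box ?a ?b" if "m \<in> {- int N..<int N}" for m
    proof -
      have "- real N \<le> of_int m" "of_int m + 1 \<le> real N"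
        using that by auto
      moreover have "k * (real N + 1/2) \<ge> k / 2"
        using k by (simp add: field_simps)
      ultimately show ?thesis
        using c by (auto simp: d_def corner_def in_box_complex_iff imag_pole_def)
    qed
    ultimately show ?thesis
      unfolding P_def by blast
  qed
  have poles: "z \<in> P" if z: "z \<in> S" "z \<in> range (real_pole k c) \<union> range imag_pole" for z
    using z(2)
  proof
    assume "z \<in> range (real_pole k c)"
    then obtain n where n: "z = real_pole k c n" by blast
    have "k * - (real N + 3/4) < k * of_int n" "k * of_int n < k * (real N + 3/4)"
      using z(1) by (auto simp: n S_def e_def d_def corner_def in_box_complex_iff real_pole_def algebra_simps)
    then have "- (real N + 3/4) < of_int n" "of_int n < real N + 3/4"
      using k by (auto simp only: mult_less_cancel_left_pos)
    then have "- int N \<le> n" "n \<le> int N"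
      by linarith+
    then show ?thesis
      unfolding P_def n by auto
  next
    assume "z \<in> range imag_pole"
    then obtain m where m: "z = imag_pole m" by blast
    have "- (real N + 1/4) < of_int m + 1/2" "of_int m + 1/2 < real N + 1/4"
      using z(1) by (auto simp: m S_def e_def d_def corner_def in_box_complex_iff imag_pole_def)
    then have "- int N \<le> m" "m < int N"
      by linarith+
    then show ?thesis
      unfolding P_def m by auto
  qed
  have cbox: "cbox ?a ?b \<subseteq> S"
    using k by (auto simp: S_def e_def in_box_complex_iff in_cbox_complex_iff)
  have image: "path_image ?\<gamma> \<subseteq> S - P"
    using inside cbox by (auto simp: path_image_rectpath_cbox_minus_box[OF order])
  with poles show "path_image ?\<gamma> \<inter> (range (real_pole k c) \<union> range imag_pole) = {}"
    by blast
  have integral: "contour_integral ?\<gamma> (kern k c) = of_real (2 * pi) * \<i> * (\<Sum>p\<in>P. winding_number ?\<gamma> p * residue (kern k c) p)"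
  proof (rule Residue_theorem[of S])
    show "kern k c holomorphic_on S - P"
      using poles by (intro holomorphic_kern[OF k]) blast
    show "\<forall>z. z \<notin> S \<longrightarrow> winding_number ?\<gamma> z = 0"
      using cbox winding_number_rectpath_outside[OF order] by blast
    show "open S"
      unfolding S_def by (rule open_box)
    show "connected S"
      unfolding S_def by (rule convex_connected[OF convex_box(2)])
    show "finite P"
      unfolding P_def by simp
    show "path_image ?\<gamma> \<subseteq> S - P"
      by (fact image)
  qed simp_all
  have "(\<Sum>p\<in>P. winding_number ?\<gamma> p * residue (kern k c) p) = (\<Sum>p\<in>P. residue (kern k c) p)"
  proof (rule sum.cong)
    fix p assume "p \<in> P"
    then have "winding_number ?\<gamma> p = 1"
      using inside by (intro winding_number_rectpath) blast
    then show "winding_number ?\<gamma> p * residue (kern k c) p = residue (kern k c) p"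
      by simp
  qed simp
  also have "\<dots> = (\<Sum>n = - int N..int N. residue (kern k c) (real_pole k c n))
        + (\<Sum>m \<in> {- int N..<int N}. residue (kern k c) (imag_pole m))"
  proof -
    have "inj_on (real_pole k c) {- int N..int N}"
      using k by (simp add: inj_on_def real_pole_def)
    moreover have "inj_on imag_pole {- int N..<int N}"
      by (simp add: inj_on_def imag_pole_def)
    moreover have "real_pole k c ` {- int N..int N} \<inter> imag_pole ` {- int N..<int N} = {}"
    proof -
      have "imag_pole m \<noteq> real_pole k c n" for m n
        using imag_pole_not_real_pole[of m k c] by blast
      then show ?thesis by (simp add: disjoint_iff image_iff) metis
    qed
    ultimately show ?thesis
      unfolding P_def by (subst sum.union_disjoint) (simp_all add: sum.reindex)
  qed
  finally have residues: "(\<Sum>p\<in>P. winding_number ?\<gamma> p * residue (kern k c) p) =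
      (\<Sum>n = - int N..int N. residue (kern k c) (real_pole k c n))
        + (\<Sum>m \<in> {- int N..<int N}. residue (kern k c) (imag_pole m))" .
  show "contour_integral ?\<gamma> (kern k c) = 2 * of_real pi * \<i> *
      ((\<Sum>n = - int N..int N. residue (kern k c) (real_pole k c n))
        + (\<Sum>m \<in> {- int N..<int N}. residue (kern k c) (imag_pole m)))"
    unfolding integral residues by (simp only: of_real_mult of_real_numeral)
qed

text \<open>The sides grow linearly in \<open>N\<close>, whereas the kernel decays exponentially on them.\<close>

lemma kern_contour_integral_tendsto_0:
  assumes k: "k > 0" and c: "\<bar>c\<bar> < k / 2"
  shows "(\<lambda>N. contour_integral (rectpath (of_real c - corner k N) (of_real c + corner k N)) (kern k c))
    \<longlonglongrightarrow> 0"
proof (rule Lim_null_comparison)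
  let ?A = "\<lambda>N. pi / k / sinh (pi * real N / k)" and ?B = "\<lambda>N. pi / k / sinh (pi * (k * real N))"
  show "(\<lambda>N. 2 * ?A N * (2 * (k * (real N + 1/2))) + 2 * ?B N * (2 * real N)) \<longlonglongrightarrow> 0"
  proof -
    have "(\<lambda>N. (4 * pi * real N + 2 * pi) / sinh (pi / k * real N)) \<longlonglongrightarrow> 0"
      by (rule linear_over_sinh_tendsto_0) (use k in simp)
    moreover have "(\<lambda>N. (4 * pi / k * real N + 0) / sinh (pi * k * real N)) \<longlonglongrightarrow> 0"
      by (rule linear_over_sinh_tendsto_0) (use k in simp)
    ultimately have "(\<lambda>N. (4 * pi * real N + 2 * pi) / sinh (pi / k * real N)
        + (4 * pi / k * real N + 0) / sinh (pi * k * real N)) \<longlonglongrightarrow> 0"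
      by (rule tendsto_add_zero)
    moreover have "2 * ?A N * (2 * (k * (real N + 1/2))) = (4 * pi * real N + 2 * pi) / sinh (pi / k * real N)"
      "2 * ?B N * (2 * real N) = (4 * pi / k * real N + 0) / sinh (pi * k * real N)" for N
      using k by (simp_all add: algebra_simps add_divide_distrib)
    ultimately show ?thesis
      by (simp only:)
  qed
  show "\<forall>\<^sub>F N in sequentially. norm (contour_integral
      (rectpath (of_real c - corner k N) (of_real c + corner k N)) (kern k c))
      \<le> 2 * ?A N * (2 * (k * (real N + 1/2))) + 2 * ?B N * (2 * real N)"
    using eventually_gt_at_top[of "0::nat"]
  proof eventually_elim
    fix N :: nat assume N: "N > 0"
    let ?a = "of_real c - corner k N" and ?b = "of_real c + corner k N"
    have "norm (contour_integral (rectpath ?a ?b) (kern k c))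
        \<le> 2 * ?A N * (Re ?b - Re ?a) + 2 * ?B N * (Im ?b - Im ?a)"
    proof (rule norm_contour_integral_rectpath_le)
      show "continuous_on (path_image (rectpath ?a ?b)) (kern k c)"
        using kern_residue_theorem(1)[OF k c N]
        by (intro holomorphic_on_imp_continuous_on holomorphic_kern[OF k])
      show "Re ?a \<le> Re ?b" "Im ?a \<le> Im ?b"
        using k by (auto simp: corner_def)
    next
      fix z assume "Im z = Im ?a \<or> Im z = Im ?b"
      then show "norm (kern k c z) \<le> ?A N"
        using N by (intro norm_kern_horizontal[OF k]) (auto simp: corner_def)
    next
      fix z assume z: "Re z = Re ?a \<or> Re z = Re ?b"
      have *: "k * (real N + 1/2) = k * real N + k / 2" "0 < k * real N"
        using k N by (auto simp: algebra_simps)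
      have "Re z = c + k * (of_int (- int N - 1) + 1/2) \<or> Re z = c + k * (of_int (int N) + 1/2)"
        using z by (auto simp: corner_def algebra_simps)
      moreover have "k * real N \<le> \<bar>Re z\<bar>"
        using z c k * by (auto simp: corner_def)
      ultimately show "norm (kern k c z) \<le> ?B N"
        using norm_kern_vertical[OF k] * by blast
    qed
    then show "norm (contour_integral (rectpath ?a ?b) (kern k c))
        \<le> 2 * ?A N * (2 * (k * (real N + 1/2))) + 2 * ?B N * (2 * real N)"
      by (simp add: corner_def)
  qed
qed

section \<open>Pairing the poles on the imaginary axis\<close>

definition imag_term :: "real \<Rightarrow> real \<Rightarrow> nat \<Rightarrow> real" where
  "imag_term k b m = (-1) ^ m * (sinh ((2 * real m + 1) * pi / (2 * k))
      / ((sinh ((2 * real m + 1) * pi / (2 * k)))\<^sup>2 + (sin b)\<^sup>2))"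

text \<open>With \<open>a = (2 m + 1) \<pi> / (2 k)\<close> and \<open>b = \<pi> c / k\<close>, the sine takes at the two poles the values
  \<open>\<plusminus> \<i> sinh a cos b - cosh a sin b\<close>. Their product is \<open>sinh\<^sup>2 a + sin\<^sup>2 b\<close>, and the factors
  \<open>(-1)^m\<close> and \<open>(-1)^(- m - 1)\<close> are opposite, so only the difference of the values, a multiple of \<open>sinh a cos b\<close>,
  survives in the numerator.\<close>

lemma residue_kern_imag_pole_pair:
  fixes m :: nat
  assumes k: "k > 0"
  shows "residue (kern k c) (imag_pole (int m)) + residue (kern k c) (imag_pole (- int m - 1))
    = of_real (- (2 * cos (pi * c / k) / k * imag_term k (pi * c / k) m))"
proof -
  define a b where "a = (2 * real m + 1) * pi / (2 * k)" and "b = pi * c / k"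
  define s t where "s = complex_of_real (sinh a * cos b)" and "t = complex_of_real (cosh a * sin b)"
  define D where "D = sinh a ^ 2 + sin b ^ 2"
  have "a > 0" using k by (simp add: a_def)
  then have D: "D > 0" by (auto simp: D_def intro: add_pos_nonneg)
  have sin_ia: "sin (\<i> * of_real a) = \<i> * of_real (sinh a)"
    using sinh_conv_sin[of "of_real a"] by (simp add: sinh_complex_of_real)
  have cos_ia: "cos (\<i> * of_real a) = of_real (cosh a)"
    using cosh_conv_cos[of "of_real a"] by (simp add: cosh_complex_of_real)
  have "of_real pi * (imag_pole (int m) - of_real c) / of_real k = \<i> * of_real a - of_real b"
    using k by (simp add: imag_pole_def a_def b_def field_simps)
  then have sin1: "sin (of_real pi * (imag_pole (int m) - of_real c) / of_real k) = \<i> * s - t"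
    by (simp add: sin_diff sin_ia cos_ia s_def t_def sin_of_real cos_of_real)
  have "of_real pi * (imag_pole (- int m - 1) - of_real c) / of_real k = - (\<i> * of_real a) - of_real b"
    using k by (simp add: imag_pole_def a_def b_def field_simps)
  then have sin2: "sin (of_real pi * (imag_pole (- int m - 1) - of_real c) / of_real k) = - (\<i> * s) - t"
    by (simp add: sin_diff sin_ia cos_ia s_def t_def sin_of_real cos_of_real)
  have "(\<i> * s - t) * (- (\<i> * s) - t) = s ^ 2 + t ^ 2"
    by (simp add: algebra_simps power2_eq_square)
  also have "\<dots> = of_real ((sinh a * cos b) ^ 2 + (cosh a * sin b) ^ 2)"
    by (simp add: s_def t_def)
  also have "(sinh a * cos b) ^ 2 + (cosh a * sin b) ^ 2 = D"
    by (simp add: D_def power_mult_distrib cosh_square_eq cos_squared_eq algebra_simps)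
  finally have prod: "(\<i> * s - t) * (- (\<i> * s) - t) = of_real D" .
  then have nz: "\<i> * s - t \<noteq> 0" "- (\<i> * s) - t \<noteq> 0"
    using D by (auto simp del: minus_diff_eq)
  have sgn: "(-1) powi (- int m - 1) = (- ((-1) ^ m) :: complex)"
  proof -
    have "- int m - 1 = - int (Suc m)"
      by simp
    then have "(-1) powi (- int m - 1) = ((-1) powi (- int (Suc m)) :: complex)"
      by (simp only:)
    also have "\<dots> = (-1) powi int (Suc m)"
      by (rule power_int_minus_one_minus)
    also have "\<dots> = - ((-1) ^ m)"
      by (simp only: power_int_of_nat power_Suc mult_minus_left mult_1_left)
    finally show ?thesis .
  qed
  have "residue (kern k c) (imag_pole (int m)) + residue (kern k c) (imag_pole (- int m - 1))
      = (-1) ^ m / (\<i> * of_real k) * (1 / (\<i> * s - t) - 1 / (- (\<i> * s) - t))"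
    unfolding residue_kern_imag_pole[OF k] sin1 sin2 sgn by (simp add: diff_divide_distrib right_diff_distrib)
  also have "1 / (\<i> * s - t) - 1 / (- (\<i> * s) - t) = ((- (\<i> * s) - t) - (\<i> * s - t)) / of_real D"
    unfolding prod[symmetric] using nz by (subst diff_frac_eq) auto
  also have "(-1) ^ m / (\<i> * of_real k) * \<dots> = - ((-1) ^ m * (2 * s / (of_real k * of_real D)))"
    by (simp add: field_simps)
  also have "\<dots> = of_real (- (2 * cos b / k * imag_term k b m))"
    by (simp add: s_def imag_term_def D_def flip: a_def)
  finally show ?thesis by (simp add: b_def)
qed

lemma sum_symmetric_int_interval:
  fixes f :: "int \<Rightarrow> 'a :: comm_monoid_add"
  shows "(\<Sum>m \<in> {- int N..<int N}. f m) = (\<Sum>m<N. f (int m) + f (- int m - 1))"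
proof (induction N)
  case (Suc N)
  have "{- int (Suc N)..<int (Suc N)} = insert (int N) (insert (- int N - 1) {- int N..<int N})"
    by auto
  then show ?case
    using Suc by (simp add: add_ac)
qed simp

section \<open>Convergence of the two series\<close>

lemma summable_on_int_geometric:
  fixes q :: real
  assumes "0 \<le> q" "q < 1"
  shows "(\<lambda>n::int. q ^ nat \<bar>n\<bar>) summable_on UNIV"
proof -
  have q: "(\<lambda>n. q ^ n) summable_on A" for A
    using summable_on_subset_banach[OF norm_summable_imp_summable_on[of "\<lambda>n. q ^ n"], of A] assms
    by (simp add: power_abs summable_geometric)
  have "(\<lambda>n::int. q ^ nat \<bar>n\<bar>) summable_on range int"
    by (subst summable_on_reindex) (auto simp: o_def q)
  moreover have "(\<lambda>n::int. q ^ nat \<bar>n\<bar>) summable_on (\<lambda>n. - int n) ` {0<..}"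
    by (subst summable_on_reindex) (auto simp: o_def q inj_on_def)
  ultimately have "(\<lambda>n::int. q ^ nat \<bar>n\<bar>) summable_on range int \<union> (\<lambda>n. - int n) ` {0<..}"
    by (rule summable_on_Un_disjoint) auto
  also have "range int \<union> (\<lambda>n. - int n) ` {0<..} = UNIV"
  proof (intro set_eqI iffI)
    fix n :: int
    show "n \<in> range int \<union> (\<lambda>n. - int n) ` {0<..}"
    proof (cases "n \<ge> 0")
      case True
      then show ?thesis by (metis UnI1 nonneg_int_cases rangeI)
    next
      case False
      then have "n = - int (nat (- n))" "nat (- n) \<in> {0<..}" by auto
      then show ?thesis by blast
    qed
  qed simp
  finally show ?thesis .
qed

lemma sech_le_exp: "sech x \<le> 2 * exp (- \<bar>x\<bar>)"
proof -
  have "exp \<bar>x\<bar> / 2 \<le> cosh \<bar>x\<bar>"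
    by (simp add: cosh_field_def)
  then have "1 / cosh x \<le> 1 / (exp \<bar>x\<bar> / 2)"
    by (intro divide_left_mono) auto
  then show ?thesis
    by (simp add: sech_def exp_minus field_simps)
qed

definition real_term :: "real \<Rightarrow> real \<Rightarrow> int \<Rightarrow> real" where
  "real_term k c n = (-1) powi n * sech (pi * (k * of_int n + c))"

lemma real_term_summable:
  assumes k: "k > 0"
  shows "real_term k c summable_on UNIV"
proof -
  let ?q = "exp (- (pi * k))" and ?C = "2 * exp (pi * \<bar>c\<bar>)"
  have "(\<lambda>n::int. ?C * ?q ^ nat \<bar>n\<bar>) summable_on UNIV"
    using k by (intro summable_on_cmult_right summable_on_int_geometric) auto
  moreover have "norm (real_term k c n) \<le> ?C * ?q ^ nat \<bar>n\<bar>" for n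
  proof -
    have "norm (real_term k c n) = sech (pi * (k * of_int n + c))"
      by (simp add: real_term_def abs_mult power_int_minus_left sech_def)
    also have "\<dots> \<le> 2 * exp (- \<bar>pi * (k * of_int n + c)\<bar>)"
      by (rule sech_le_exp)
    also have "\<dots> \<le> 2 * exp (pi * \<bar>c\<bar> - pi * k * \<bar>of_int n\<bar>)"
    proof -
      have "\<bar>k * of_int n\<bar> \<le> \<bar>k * of_int n + c\<bar> + \<bar>c\<bar>" by linarith
      then have "k * \<bar>of_int n\<bar> \<le> \<bar>k * of_int n + c\<bar> + \<bar>c\<bar>"
        using k by (simp add: abs_mult)
      then have "pi * (k * \<bar>of_int n\<bar>) \<le> pi * (\<bar>k * of_int n + c\<bar> + \<bar>c\<bar>)"
        by (intro mult_left_mono) auto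
      moreover have "\<bar>pi * (k * of_int n + c)\<bar> = pi * \<bar>k * of_int n + c\<bar>"
        by (simp only: abs_mult) simp
      ultimately have "pi * k * \<bar>of_int n\<bar> \<le> \<bar>pi * (k * of_int n + c)\<bar> + pi * \<bar>c\<bar>"
        by (simp only: distrib_left mult.assoc)
      then show ?thesis
        by simp
    qed
    also have "\<dots> = ?C * ?q ^ nat \<bar>n\<bar>"
      by (simp add: exp_diff exp_minus field_simps flip: exp_of_nat_mult)
    finally show ?thesis .
  qed
  ultimately have "(\<lambda>n. norm (real_term k c n)) summable_on UNIV"
    by (rule Infinite_Sum.abs_summable_on_comparison_test')
  then show ?thesis
    by (rule abs_summable_summable)
qed

lemma imag_term_summable:
  assumes k: "k > 0"
  shows "summable (imag_term k b)"
proof (rule summable_comparison_test)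
  let ?s = "\<lambda>m. sinh ((2 * real m + 1) * pi / (2 * k))"
  show "summable (\<lambda>m. inverse (?s m))"
  proof (rule summable_comparison_test_bigo)
    show "summable (\<lambda>m. norm (exp (- pi / k) ^ m))"
      using k by (auto intro!: summable_geometric)
    show "(\<lambda>m. inverse (?s m)) \<in> O(\<lambda>m. exp (- pi / k) ^ m)"
      using k unfolding sinh_field_def exp_of_nat_mult[symmetric] by real_asymp
  qed
  have "norm (imag_term k b m) \<le> inverse (?s m)" for m
  proof -
    have s: "?s m > 0" using k by simp
    then have "?s m / ((?s m)\<^sup>2 + (sin b)\<^sup>2) \<le> ?s m / (?s m)\<^sup>2"
      by (intro divide_left_mono) (auto intro!: mult_pos_pos add_pos_nonneg)
    also have "\<dots> = inverse (?s m)"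
      using s by (simp add: power2_eq_square field_simps)
    finally show ?thesis
      using s by (simp add: imag_term_def abs_mult power_abs)
  qed
  then show "\<exists>N. \<forall>m\<ge>N. norm (imag_term k b m) \<le> inverse (?s m)" by blast
qed

lemma symmetric_int_intervals_filterlim:
  "filterlim (\<lambda>N. {- int N..int N}) (finite_subsets_at_top UNIV) sequentially"
  unfolding filterlim_finite_subsets_at_top
proof (intro allI impI)
  fix X :: "int set" assume "finite X \<and> X \<subseteq> UNIV"
  then have "finite ((\<lambda>x. \<bar>x\<bar>) ` X)" by simp
  then have B: "\<forall>x\<in>X. \<bar>x\<bar> \<le> Max ((\<lambda>x. \<bar>x\<bar>) ` X)"
    by auto
  show "\<forall>\<^sub>F N in sequentially. finite {- int N..int N} \<and> X \<subseteq> {- int N..int N} \<and> {- int N..int N} \<subseteq> UNIV"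
    using eventually_ge_at_top[of "nat (Max ((\<lambda>x. \<bar>x\<bar>) ` X))"]
  proof eventually_elim
    case (elim N)
    then have "\<bar>x\<bar> \<le> int N" if "x \<in> X" for x
      using B that by force
    then show ?case by force
  qed
qed

section \<open>Equality of the two series\<close>

lemma infsum_real_term_eq:
  assumes k: "k > 0" and c: "\<bar>c\<bar> < k / 2"
  shows "infsum (real_term k c) UNIV
    = 2 * cos (pi * c / k) / k * suminf (imag_term k (pi * c / k))"
proof -
  let ?L = "2 * cos (pi * c / k) / k" and ?b = "pi * c / k"
  let ?I = "\<lambda>N. contour_integral (rectpath (of_real c - corner k N) (of_real c + corner k N)) (kern k c)"
  let ?S = "\<lambda>N. sum (real_term k c) {- int N..int N} - ?L * sum (imag_term k ?b) {..<N}"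
  have eq: "?I N = 2 * of_real pi * \<i> * of_real (?S N)" if N: "N > 0" for N
    unfolding kern_residue_theorem(2)[OF k c N] sum_symmetric_int_interval
      residue_kern_imag_pole_pair[OF k] residue_kern_real_pole[OF k]
    by (simp add: real_term_def sum_negf sum_distrib_left)
  have "(\<lambda>N. ?I N / (2 * of_real pi * \<i>)) \<longlonglongrightarrow> 0"
    by (rule tendsto_divide_zero[OF kern_contour_integral_tendsto_0[OF k c]])
  moreover have "\<forall>\<^sub>F N in sequentially. ?I N / (2 * of_real pi * \<i>) = of_real (?S N)"
    using eventually_gt_at_top[of "0::nat"] by eventually_elim (subst eq; simp)
  ultimately have "(\<lambda>N. complex_of_real (?S N)) \<longlonglongrightarrow> of_real 0"
    by (simp only: tendsto_cong of_real_0)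
  then have "?S \<longlonglongrightarrow> 0"
    by (simp only: tendsto_of_real_iff)
  moreover have "?S \<longlonglongrightarrow> infsum (real_term k c) UNIV - ?L * suminf (imag_term k ?b)"
  proof (intro tendsto_intros)
    have "(sum (real_term k c) \<longlongrightarrow> infsum (real_term k c) UNIV) (finite_subsets_at_top UNIV)"
      using has_sum_infsum[OF real_term_summable[OF k]] by (simp add: has_sum_def)
    then show "(\<lambda>N. sum (real_term k c) {- int N..int N}) \<longlonglongrightarrow> infsum (real_term k c) UNIV"
      by (rule filterlim_compose) (rule symmetric_int_intervals_filterlim)
    show "(\<lambda>N. sum (imag_term k ?b) {..<N}) \<longlonglongrightarrow> suminf (imag_term k ?b)"
      using summable_LIMSEQ[OF imag_term_summable[OF k]] .
  qed
  ultimately show ?thesis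
    using LIMSEQ_unique by fastforce
qed

lemma bij_flip_odd: "bij (\<lambda>n::int. if even n then n else - n)"
  by (rule involuntory_imp_bij) auto

theorem mainTheorem11:
  fixes k y :: real
  assumes "k > 0" and "y \<in> {-k<..<k}"
  shows "(\<lambda>n::int. (-1) powi n * sech (pi / 2 * (2 * k * of_int n + (-1) powi n * y))) summable_on UNIV
    \<and> summable (\<lambda>m::nat. (-1) ^ m * (sinh ((2 * real m + 1) * pi / (2 * k))
          / ((sinh ((2 * real m + 1) * pi / (2 * k)))\<^sup>2 + (sin (pi * y / (2 * k)))\<^sup>2)))
    \<and> (\<Sum>\<^sub>\<infinity>n::int. (-1) powi n * sech (pi / 2 * (2 * k * of_int n + (-1) powi n * y)))
      = 2 * cos (pi * y / (2 * k)) / k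
        * (\<Sum>m::nat. (-1) ^ m * (sinh ((2 * real m + 1) * pi / (2 * k))
          / ((sinh ((2 * real m + 1) * pi / (2 * k)))\<^sup>2 + (sin (pi * y / (2 * k)))\<^sup>2)))"
proof -
  let ?\<sigma> = "\<lambda>n::int. if even n then n else - n"
  have sech_minus: "sech (- x) = sech x" for x
    by (simp add: sech_def)
  have "(-1) powi n * sech (pi / 2 * (2 * k * of_int n + (-1) powi n * y)) = real_term k (y / 2) (?\<sigma> n)" for n
  proof (cases "even n")
    case True
    then show ?thesis
      by (simp add: real_term_def algebra_simps)
  next
    case False
    have "pi / 2 * (2 * k * of_int n - y) = - (pi * (k * of_int (- n) + y / 2))"
      by (simp add: algebra_simps)
    with False show ?thesis
      by (simp add: real_term_def sech_minus power_int_minus_left del: of_int_minus)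
  qed
  then have lhs: "(\<lambda>n::int. (-1) powi n * sech (pi / 2 * (2 * k * of_int n + (-1) powi n * y)))
      = (\<lambda>n. real_term k (y / 2) (?\<sigma> n))"
    by blast
  have rhs: "(\<lambda>m::nat. (-1) ^ m * (sinh ((2 * real m + 1) * pi / (2 * k))
          / ((sinh ((2 * real m + 1) * pi / (2 * k)))\<^sup>2 + (sin (pi * y / (2 * k)))\<^sup>2)))
      = imag_term k (pi * y / (2 * k))"
    by (simp add: imag_term_def fun_eq_iff)
  have "infsum (real_term k (y / 2)) UNIV = 2 * cos (pi * y / (2 * k)) / k * suminf (imag_term k (pi * y / (2 * k)))"
    using infsum_real_term_eq[of k "y / 2"] assms by (auto simp: abs_less_iff)
  then show ?thesis
    unfolding lhs rhs summable_on_reindex_bij_betw[OF bij_flip_odd] infsum_reindex_bij_betw[OF bij_flip_odd]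
    using real_term_summable imag_term_summable assms by blast
qed

end
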